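(* Let $\mathbb{X}\subseteq\mathbb{R}^d$, let $l\ge 0$ be an integer, and let $\xi(x)$, $x\in\mathbb{X}$, be a Gaussian process which is an unknown representation of an intrinsic random function $\xi_{\rm G}$ of order $l$ (IRF$(l)$) with stationary generalized covariance $k(h)$. Let $(x_i)_{i\ge 1}$ be a sequence of points of $\mathbb{X}$, let $u\in\mathbb{R}$, and let $\xi_n(x)$ be the intrinsic Kriging predictor of $\xi(x)$ based on the observations $\xi(x_i)$, $i=1,\dots,n$. Define $\sigma_n(x):=\operatorname{var}[\xi(x)-\xi_n(x)]^{1/2}$. Then, for $x\in\mathbb{X}$, $$\mathsf{E}\Big[\big(\mathbf{1}_{\xi(x)\ge u}-\mathbf{1}_{\xi_n(x)\ge u}\big)^2\Big]=O\Big(\sigma_n(x)\,\lvert\log(\sigma_n(x))\rvert^{1/2}\Big)\quad\text{when }\sigma_n(x)\to 0 .$$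
   Context: Polynomials and measures: $\mathcal{N}_l$ is the space of polynomials on $\mathbb{R}^d$ of total degree at most $l$. $\tilde\Lambda_l$ is the space of finite-support measures $\lambda=\sum_{i=1}^m\lambda_i\delta_{x_i}$ ($x_i\in\mathbb{X}$, $\lambda_i\in\mathbb{R}$) such that $\sum_i\lambda_i f(x_i)=0$ for all $f\in\mathcal{N}_l$. IRF$(l)$: a linear map $\xi_{\rm G}$ on $\tilde\Lambda_l$ with values in the space $L^2(\Omega,\mathcal{A},\mathsf{P})$ of second-order random variables, such that $\mathsf{E}[\xi_{\rm G}(\lambda)]=0$ for all $\lambda$ and $\operatorname{cov}[\xi_{\rm G}(\lambda),\xi_{\rm G}(\mu)]=\sum_{i,j}\lambda_i\mu_j k(x_i-y_j)$ for $\lambda=\sum_i\lambda_i\delta_{x_i}$, $\mu=\sum_j\mu_j\delta_{y_j}$ in $\tilde\Lambda_l$. Here the generalized covariance $k$ is symmetric and conditionally positive definite, i.e. the variance expression is $\ge 0$ for every $\lambda\in\tilde\Lambda_l$. The map $\xi_{\rm G}$ is extended by continuity to the completion $\Lambda_l$ of $\tilde\Lambda_l$ under the inner product given by this covariance. Representation: a second-order random process $\xi(x)$, $x\in\mathbb{X}$, is a representation of $\xi_{\rm G}$ if $\xi_{\rm G}(\lambda)=\xi(\lambda)$ for all $\lambda\in\Lambda_l$, where $\xi(\lambda):=\sum_i\lambda_i\xi(x_i)$ for $\lambda=\sum_i\lambda_i\delta_{x_i}\in\tilde\Lambda_l$, extended by continuity. The process $\xi$ is (separable) Gaussian with mean in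 $\mathcal{N}_l$ (the coefficients of the mean are unknown to the predictor). Intrinsic Kriging predictor (noise-free observations): $\xi_n(x)=\sum_{i=1}^n\lambda_{i,x}\,\xi(x_i)$, where the real coefficients $\lambda_{i,x}$ minimize $\operatorname{var}[\xi(x)-\xi_n(x)]$ under the constraint $\delta_x-\sum_{i=1}^n\lambda_{i,x}\delta_{x_i}\in\Lambda_l$ (that is, $\sum_i\lambda_{i,x}p(x_i)=p(x)$ for all $p\in\mathcal{N}_l$).
   Formalization: The formal theorem also assumes that ξ(x) is not almost surely equal to u; without this the claim fails, e.g. for Brownian motion with ξ(0)=0, l=0, x=0, u=0, x_i=1/i, where the left side is always 1/2 although σ_n(x)→0. *)

theory Defs
  imports "HOL-Probability.Probability" "HOL-Library.Landau_Symbols" "HOL-Library.Poly_Mapping"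
begin

text \<open>Polynomial functions on \<open>\<real>\<^sup>d\<close> of total degree at most \<open>l\<close>; the sum ranges over the
  (finitely many) multi-indices of total degree at most \<open>l\<close>.\<close>

definition polys_upto :: "nat \<Rightarrow> ((real^'d) \<Rightarrow> real) set" where
  "polys_upto l = {p. \<exists>c :: ('d \<Rightarrow> nat) \<Rightarrow> real.
      p = (\<lambda>x. \<Sum>\<alpha> | (\<Sum>i\<in>UNIV. \<alpha> i) \<le> l. c \<alpha> * (\<Prod>i\<in>UNIV. (x $ i) ^ \<alpha> i))}"

text \<open>A measure of finite support is a finitely supported function: \<open>Poly_Mapping.lookup \<nu> x\<close>
  is the mass of \<open>\<nu>\<close> at \<open>x\<close>, and \<open>Poly_Mapping.single x a\<close> is \<open>a \<delta>\<^sub>x\<close>.\<close>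

type_synonym 'd fmeasure = "(real^'d) \<Rightarrow>\<^sub>0 real"

definition fm_apply :: "'d fmeasure \<Rightarrow> ((real^'d) \<Rightarrow> real) \<Rightarrow> real" where
  "fm_apply \<nu> f = (\<Sum>x\<in>Poly_Mapping.keys \<nu>. Poly_Mapping.lookup \<nu> x * f x)"

definition increments :: "(real^'d) set \<Rightarrow> nat \<Rightarrow> 'd fmeasure set" where
  "increments X l = {\<nu>. Poly_Mapping.keys \<nu> \<subseteq> X \<and> (\<forall>p\<in>polys_upto l. fm_apply \<nu> p = 0)}"

definition gcov :: "((real^'d) \<Rightarrow> real) \<Rightarrow> 'd fmeasure \<Rightarrow> 'd fmeasure \<Rightarrow> real" where
  "gcov k \<nu> \<mu> = (\<Sum>x\<in>Poly_Mapping.keys \<nu>. \<Sum>y\<in>Poly_Mapping.keys \<mu>.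
     Poly_Mapping.lookup \<nu> x * Poly_Mapping.lookup \<mu> y * k (x - y))"

definition generalized_covariance :: "(real^'d) set \<Rightarrow> nat \<Rightarrow> ((real^'d) \<Rightarrow> real) \<Rightarrow> bool" where
  "generalized_covariance X l k \<longleftrightarrow>
     (\<forall>h. k (- h) = k h) \<and> (\<forall>\<nu>\<in>increments X l. gcov k \<nu> \<nu> \<ge> 0)"

definition second_order_rv :: "'w measure \<Rightarrow> ('w \<Rightarrow> real) \<Rightarrow> bool" where
  "second_order_rv M Y \<longleftrightarrow> Y \<in> borel_measurable M \<and> integrable M (\<lambda>\<omega>. (Y \<omega>)\<^sup>2)"

definition cov :: "'w measure \<Rightarrow> ('w \<Rightarrow> real) \<Rightarrow> ('w \<Rightarrow> real) \<Rightarrow> real" where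
  "cov M Y Z = (\<integral>\<omega>. (Y \<omega> - (\<integral>\<omega>'. Y \<omega>' \<partial>M)) * (Z \<omega> - (\<integral>\<omega>'. Z \<omega>' \<partial>M)) \<partial>M)"

abbreviation var :: "'w measure \<Rightarrow> ('w \<Rightarrow> real) \<Rightarrow> real" where
  "var M Y \<equiv> prob_space.variance M Y"

text \<open>Intrinsic random functions of order \<open>l\<close>. Elements of \<open>L\<^sup>2\<close> are represented by functions,
  so linearity holds up to almost sure equality.\<close>

definition IRF ::
  "'w measure \<Rightarrow> (real^'d) set \<Rightarrow> nat \<Rightarrow> ((real^'d) \<Rightarrow> real) \<Rightarrow> ('d fmeasure \<Rightarrow> 'w \<Rightarrow> real) \<Rightarrow> bool"
where
  "IRF M X l k \<xi>G \<longleftrightarrow>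
     generalized_covariance X l k \<and>
     (\<forall>\<nu>\<in>increments X l. second_order_rv M (\<xi>G \<nu>)) \<and>
     (\<forall>\<nu>\<in>increments X l. \<forall>\<mu>\<in>increments X l.
        AE \<omega> in M. \<xi>G (\<nu> + \<mu>) \<omega> = \<xi>G \<nu> \<omega> + \<xi>G \<mu> \<omega>) \<and>
     (\<forall>\<nu>\<in>increments X l. \<forall>c::real.
        AE \<omega> in M. \<xi>G (Poly_Mapping.map ((*) c) \<nu>) \<omega> = c * \<xi>G \<nu> \<omega>) \<and>
     (\<forall>\<nu>\<in>increments X l. (\<integral>\<omega>. \<xi>G \<nu> \<omega> \<partial>M) = 0) \<and>
     (\<forall>\<nu>\<in>increments X l. \<forall>\<mu>\<in>increments X l. cov M (\<xi>G \<nu>) (\<xi>G \<mu>) = gcov k \<nu> \<mu>)"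

text \<open>An element of the completion of \<open>increments X l\<close> is given by a sequence that is Cauchy for
  the seminorm induced by \<open>gcov k\<close>. The value at this element of the extension by continuity of
  \<open>F\<close> is the \<open>L\<^sup>2\<close> limit of \<open>F\<close> along the sequence; an increment is given by a constant sequence.\<close>

definition completion_seqs ::
  "(real^'d) set \<Rightarrow> nat \<Rightarrow> ((real^'d) \<Rightarrow> real) \<Rightarrow> (nat \<Rightarrow> 'd fmeasure) set" where
  "completion_seqs X l k = {\<nu>s. (\<forall>m. \<nu>s m \<in> increments X l) \<and>
     (\<forall>e>0. \<exists>N. \<forall>m\<ge>N. \<forall>n\<ge>N. gcov k (\<nu>s m - \<nu>s n) (\<nu>s m - \<nu>s n) < e)}"

definition is_extension_value ::
  "'w measure \<Rightarrow> ('d fmeasure \<Rightarrow> 'w \<Rightarrow> real) \<Rightarrow> (nat \<Rightarrow> 'd fmeasure) \<Rightarrow> ('w \<Rightarrow> real) \<Rightarrow> bool" where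
  "is_extension_value M F \<nu>s Z \<longleftrightarrow> second_order_rv M Z \<and>
     (\<lambda>m. \<integral>\<omega>. (F (\<nu>s m) \<omega> - Z \<omega>)\<^sup>2 \<partial>M) \<longlonglongrightarrow> 0"

definition process_apply :: "((real^'d) \<Rightarrow> 'w \<Rightarrow> real) \<Rightarrow> 'd fmeasure \<Rightarrow> 'w \<Rightarrow> real" where
  "process_apply \<xi> \<nu> \<omega> = fm_apply \<nu> (\<lambda>x. \<xi> x \<omega>)"

definition representation ::
  "'w measure \<Rightarrow> (real^'d) set \<Rightarrow> nat \<Rightarrow> ((real^'d) \<Rightarrow> real) \<Rightarrow>
   ('d fmeasure \<Rightarrow> 'w \<Rightarrow> real) \<Rightarrow> ((real^'d) \<Rightarrow> 'w \<Rightarrow> real) \<Rightarrow> bool" where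
  "representation M X l k \<xi>G \<xi> \<longleftrightarrow>
     (\<forall>x\<in>X. second_order_rv M (\<xi> x)) \<and>
     (\<forall>\<nu>s\<in>completion_seqs X l k. \<forall>Z Z'.
        is_extension_value M \<xi>G \<nu>s Z \<longrightarrow> is_extension_value M (process_apply \<xi>) \<nu>s Z' \<longrightarrow>
        (AE \<omega> in M. Z \<omega> = Z' \<omega>))"

text \<open>Normal laws, including the degenerate ones (Dirac masses).\<close>

definition gaussian_rv :: "'w measure \<Rightarrow> ('w \<Rightarrow> real) \<Rightarrow> bool" where
  "gaussian_rv M Y \<longleftrightarrow> Y \<in> borel_measurable M \<and>
     ((\<exists>m s. s > 0 \<and> distributed M lborel Y (normal_density m s)) \<or>
      (\<exists>m. AE \<omega> in M. Y \<omega> = m))"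

definition gaussian_process :: "'w measure \<Rightarrow> (real^'d) set \<Rightarrow> ((real^'d) \<Rightarrow> 'w \<Rightarrow> real) \<Rightarrow> bool" where
  "gaussian_process M X \<xi> \<longleftrightarrow>
     (\<forall>\<nu> :: 'd fmeasure. Poly_Mapping.keys \<nu> \<subseteq> X \<longrightarrow> gaussian_rv M (process_apply \<xi> \<nu>))"

text \<open>Separability in the sense of Doob.\<close>

definition separable_process :: "'w measure \<Rightarrow> (real^'d) set \<Rightarrow> ((real^'d) \<Rightarrow> 'w \<Rightarrow> real) \<Rightarrow> bool" where
  "separable_process M X \<xi> \<longleftrightarrow>
     (\<exists>D. countable D \<and> D \<subseteq> X \<and> X \<subseteq> closure D \<and>
        (AE \<omega> in M. \<forall>G F. open G \<longrightarrow> closed F \<longrightarrow>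
           (\<forall>t\<in>G \<inter> D. \<xi> t \<omega> \<in> F) \<longrightarrow> (\<forall>t\<in>G \<inter> X. \<xi> t \<omega> \<in> F)))"

definition kriging_predictor ::
  "((real^'d) \<Rightarrow> 'w \<Rightarrow> real) \<Rightarrow> (nat \<Rightarrow> real^'d) \<Rightarrow> nat \<Rightarrow> (nat \<Rightarrow> real) \<Rightarrow> 'w \<Rightarrow> real" where
  "kriging_predictor \<xi> xs n c \<omega> = (\<Sum>i=1..n. c i * \<xi> (xs i) \<omega>)"

definition kriging_admissible ::
  "(real^'d) set \<Rightarrow> nat \<Rightarrow> (nat \<Rightarrow> real^'d) \<Rightarrow> nat \<Rightarrow> real^'d \<Rightarrow> (nat \<Rightarrow> real) \<Rightarrow> bool" where
  "kriging_admissible X l xs n x c \<longleftrightarrow>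
     Poly_Mapping.single x 1 - (\<Sum>i=1..n. Poly_Mapping.single (xs i) (c i)) \<in> increments X l"

definition kriging_variance ::
  "'w measure \<Rightarrow> ((real^'d) \<Rightarrow> 'w \<Rightarrow> real) \<Rightarrow> (nat \<Rightarrow> real^'d) \<Rightarrow> nat \<Rightarrow> real^'d \<Rightarrow>
   (nat \<Rightarrow> real) \<Rightarrow> real" where
  "kriging_variance M \<xi> xs n x c = var M (\<lambda>\<omega>. \<xi> x \<omega> - kriging_predictor \<xi> xs n c \<omega>)"

definition kriging_weights ::
  "'w measure \<Rightarrow> (real^'d) set \<Rightarrow> nat \<Rightarrow> ((real^'d) \<Rightarrow> 'w \<Rightarrow> real) \<Rightarrow> (nat \<Rightarrow> real^'d) \<Rightarrow> nat \<Rightarrow>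
   real^'d \<Rightarrow> (nat \<Rightarrow> real) \<Rightarrow> bool" where
  "kriging_weights M X l \<xi> xs n x c \<longleftrightarrow>
     kriging_admissible X l xs n x c \<and>
     (\<forall>c'. kriging_admissible X l xs n x c' \<longrightarrow>
        kriging_variance M \<xi> xs n x c \<le> kriging_variance M \<xi> xs n x c')"

end

theory Submission
  imports Defs
begin

text \<open>
  If the indicators of \<open>Y \<ge> u\<close> and \<open>Z \<ge> u\<close> differ, then \<open>\<bar>Y - u\<bar> \<le> t\<close> or \<open>\<bar>Y - Z\<bar> \<ge> t\<close>.
  With \<open>Y = \<xi> x\<close> and \<open>Z\<close> the predictor, the first event has probability \<open>O(t)\<close>, because the law of
  \<open>\<xi> x\<close> has a bounded density (or is a Dirac mass away from \<open>u\<close>). The prediction error is an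
  increment, hence a centred Gaussian variable of variance \<open>\<sigma>\<^sup>2\<close>, so the second event has probability
  at most \<open>\<surd>2 exp (- t\<^sup>2 / (4\<sigma>\<^sup>2))\<close>. The choice \<open>t = 2 \<sigma> \<bar>ln \<sigma>\<bar>\<^sup>1\<^sup>/\<^sup>2\<close> balances the two.
\<close>

section \<open>Linearity of finitely supported measures\<close>

lemma fm_apply_eq_sum:
  assumes "finite S" "Poly_Mapping.keys \<nu> \<subseteq> S"
  shows "fm_apply \<nu> f = (\<Sum>x\<in>S. Poly_Mapping.lookup \<nu> x * f x)"
  unfolding fm_apply_def
  by (rule sum.mono_neutral_left) (use assms in \<open>auto simp: in_keys_iff\<close>)

lemma fm_apply_single: "fm_apply (Poly_Mapping.single x a) f = a * f x"
  by (subst fm_apply_eq_sum[of "{x}"]) auto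

lemma fm_apply_add: "fm_apply (\<nu> + \<mu>) f = fm_apply \<nu> f + fm_apply \<mu> f"
proof -
  \<comment> \<open>Cancellation can make the support of the sum smaller than the union, so all
    three evaluations are rewritten as sums over the common set \<open>S\<close>, where the extra
    points carry mass 0.\<close>
  define S where "S = Poly_Mapping.keys \<nu> \<union> Poly_Mapping.keys \<mu>"
  have S: "finite S" "Poly_Mapping.keys \<nu> \<subseteq> S" "Poly_Mapping.keys \<mu> \<subseteq> S"
    "Poly_Mapping.keys (\<nu> + \<mu>) \<subseteq> S"
    using Poly_Mapping.keys_add[of \<nu> \<mu>] by (auto simp: S_def)
  show ?thesis
    using S by (simp add: fm_apply_eq_sum[of S] lookup_add distrib_right sum.distrib)
qed

lemma fm_apply_diff: "fm_apply (\<nu> - \<mu>) f = fm_apply \<nu> f - fm_apply \<mu> f"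
  using fm_apply_add[of "\<nu> - \<mu>" \<mu> f] by simp

lemma fm_apply_sum: "fm_apply (\<Sum>i\<in>I. \<nu> i) f = (\<Sum>i\<in>I. fm_apply (\<nu> i) f)"
  by (induction I rule: infinite_finite_induct) (simp_all add: fm_apply_add, simp_all add: fm_apply_def)

lemma process_apply_kriging_error:
  "process_apply \<xi> (Poly_Mapping.single x 1 - (\<Sum>i=1..n. Poly_Mapping.single (xs i) (c i))) \<omega> =
     \<xi> x \<omega> - kriging_predictor \<xi> xs n c \<omega>"
  by (simp add: process_apply_def kriging_predictor_def fm_apply_diff fm_apply_sum fm_apply_single)

section \<open>Centred increments and Gaussian probability bounds\<close>

context prob_space
begin

lemma second_order_rv_integrable: "second_order_rv M Y \<Longrightarrow> integrable M Y"
  unfolding second_order_rv_def using square_integrable_imp_integrable by blast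

text \<open>The mean function lies in \<open>polys_upto l\<close> and increments annihilate that
  space, so the unknown mean drops out by linearity of the expectation.\<close>

lemma expectation_process_increment:
  assumes "\<nu> \<in> increments X l" "p \<in> polys_upto l"
    and "\<And>y. y \<in> X \<Longrightarrow> integrable M (\<xi> y)" "\<And>y. y \<in> X \<Longrightarrow> expectation (\<xi> y) = p y"
  shows "expectation (process_apply \<xi> \<nu>) = 0"
proof -
  have keys: "Poly_Mapping.keys \<nu> \<subseteq> X" and 0: "fm_apply \<nu> p = 0"
    using assms(1,2) by (auto simp: increments_def)
  have "expectation (process_apply \<xi> \<nu>) =
      (\<Sum>y\<in>Poly_Mapping.keys \<nu>. Poly_Mapping.lookup \<nu> y * expectation (\<xi> y))"
    unfolding process_apply_def fm_apply_def using keys assms(3)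
    by (subst Bochner_Integration.integral_sum) auto
  also have "\<dots> = fm_apply \<nu> p"
    unfolding fm_apply_def using keys assms(4) by (intro sum.cong) auto
  finally show ?thesis using 0 by simp
qed

text \<open>Domination of the density is required only on \<open>A\<close>, while \<open>g\<close>
  is integrated over the whole line. The tail bound takes for \<open>g\<close> a multiple of a wider
  normal density, the small-ball bound a multiple of an indicator.\<close>

lemma distributed_prob_le:
  fixes f g :: "real \<Rightarrow> real"
  assumes D: "distributed M lborel Y f" and A: "A \<in> sets borel" and g: "integrable lborel g"
    and "\<And>x. x \<in> A \<Longrightarrow> f x \<le> g x" and nonneg: "\<And>x. 0 \<le> g x"
  shows "prob {\<omega> \<in> space M. Y \<omega> \<in> A} \<le> (\<integral>x. g x \<partial>lborel)"
proof -
  have "emeasure M {\<omega> \<in> space M. Y \<omega> \<in> A} = (\<integral>\<^sup>+x. ennreal (f x) * indicator A x \<partial>lborel)"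
    using distributed_emeasure[OF D, of A] A by (simp add: vimage_def Int_def conj_commute)
  also have "\<dots> \<le> (\<integral>\<^sup>+x. ennreal (g x) \<partial>lborel)"
    by (intro nn_integral_mono) (use assms(4) in \<open>auto simp: indicator_def intro: ennreal_leI\<close>)
  also have "\<dots> = ennreal (\<integral>x. g x \<partial>lborel)"
    by (rule nn_integral_eq_integral) (use g nonneg in auto)
  finally show ?thesis
    using nonneg by (simp add: emeasure_eq_measure integral_nonneg_AE)
qed

lemma gaussian_rv_cases:
  assumes "gaussian_rv M Y"
  obtains (density) m s where "s > 0" "distributed M lborel Y (normal_density m s)"
  | (dirac) m where "AE \<omega> in M. Y \<omega> = m"
  using assms unfolding gaussian_rv_def by blast

text \<open>Half of the Gaussian exponent is bounded by its value at \<open>t\<close>; the other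
  half is, up to a factor \<open>sqrt 2\<close>, the normal density of variance
  \<open>2 * s^2\<close>, which integrates to 1.\<close>

lemma gaussian_rv_tail:
  assumes Y: "gaussian_rv M Y" and mean: "expectation Y = 0" and t: "t \<ge> 0"
  shows "prob {\<omega> \<in> space M. \<bar>Y \<omega>\<bar> \<ge> t} \<le> sqrt 2 * exp (- t\<^sup>2 / (4 * variance Y))"
  using Y
proof (cases rule: gaussian_rv_cases)
  case (density m s)
  have "m = 0"
    using normal_distributed_expectation[OF density] mean by simp
  have var: "variance Y = s\<^sup>2"
    using normal_distributed_variance[OF density] .
  have le: "normal_density 0 s x \<le> sqrt 2 * exp (- t\<^sup>2 / (4 * s\<^sup>2)) * normal_density 0 (sqrt 2 * s) x"
    if "x \<in> {x. \<bar>x\<bar> \<ge> t}" for x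
  proof -
    have "t\<^sup>2 \<le> x\<^sup>2"
      using that t power_mono[of t "\<bar>x\<bar>" 2] by simp
    then have "exp (- x\<^sup>2 / (4 * s\<^sup>2)) \<le> exp (- t\<^sup>2 / (4 * s\<^sup>2))"
      using density(1) by (simp add: field_simps)
    \<comment> \<open>The exponent \<open>- x^2 / (2 * s^2)\<close> is split into two equal parts;
      the factor \<open>sqrt 2\<close> is the ratio of the normalising constants for
      \<open>sqrt 2 * s\<close> and \<open>s\<close>.\<close>
    moreover have "normal_density 0 s x =
        exp (- x\<^sup>2 / (4 * s\<^sup>2)) * (sqrt 2 * normal_density 0 (sqrt 2 * s) x)"
      using density(1)
      by (simp add: normal_density_def real_sqrt_mult power_mult_distrib field_simps flip: exp_add)
    ultimately show ?thesis
      by (simp add: mult.assoc mult.left_commute mult_right_mono)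
  qed
  have "prob {\<omega> \<in> space M. Y \<omega> \<in> {x. \<bar>x\<bar> \<ge> t}} \<le>
      (\<integral>x. sqrt 2 * exp (- t\<^sup>2 / (4 * s\<^sup>2)) * normal_density 0 (sqrt 2 * s) x \<partial>lborel)"
    by (rule distributed_prob_le[OF density(2)]) (use le density(1) \<open>m = 0\<close> in auto)
  then show ?thesis
    using var density(1) by simp
next
  case (dirac m)
  have Ym: "Y \<in> borel_measurable M"
    using Y by (simp add: gaussian_rv_def)
  have "expectation Y = expectation (\<lambda>\<omega>. m)"
    by (rule integral_cong_AE) (use Ym dirac in auto)
  then have "m = 0"
    using mean by (simp add: prob_space)
  have "variance Y = expectation (\<lambda>\<omega>. 0)"
    by (rule integral_cong_AE) (use Ym dirac mean \<open>m = 0\<close> in auto)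
  \<comment> \<open>With variance 0, division by zero makes the exponent 0, so the right-hand side
    is \<open>sqrt 2\<close>, which exceeds any probability.\<close>
  then show ?thesis
    by (auto intro: order_trans[OF prob_le_1])
qed

text \<open>A normal density is bounded by its peak and the interval has length
  \<open>2 * t\<close>. For a Dirac mass, \<open>nondeg\<close> puts the atom at a positive distance
  from \<open>u\<close>.\<close>

lemma gaussian_rv_small_ball:
  assumes Y: "gaussian_rv M Y" and nondeg: "\<not> (AE \<omega> in M. Y \<omega> = u)"
  obtains K where "K \<ge> 0" "\<And>t. t \<ge> 0 \<Longrightarrow> prob {\<omega> \<in> space M. \<bar>Y \<omega> - u\<bar> \<le> t} \<le> K * t"
  using Y
proof (cases rule: gaussian_rv_cases)
  case (density m s)
  define b where "b = 1 / sqrt (2 * pi * s\<^sup>2)"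
  have "b \<ge> 0" by (simp add: b_def)
  have "prob {\<omega> \<in> space M. \<bar>Y \<omega> - u\<bar> \<le> t} \<le> 2 * b * t" if "t \<ge> 0" for t
  proof -
    have "normal_density m s x \<le> b" for x
      using mult_left_mono[OF _ \<open>b \<ge> 0\<close>, of "exp (- (x - m)\<^sup>2 / (2 * s\<^sup>2))" 1]
      by (simp add: normal_density_def b_def)
    then have "prob {\<omega> \<in> space M. Y \<omega> \<in> {u - t..u + t}} \<le>
        (\<integral>x. b * indicator {u - t..u + t} x \<partial>lborel)"
      by (intro distributed_prob_le[OF density(2)]) (use \<open>b \<ge> 0\<close> that in auto)
    also have "{\<omega> \<in> space M. Y \<omega> \<in> {u - t..u + t}} = {\<omega> \<in> space M. \<bar>Y \<omega> - u\<bar> \<le> t}"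
      by auto
    finally show ?thesis using that by simp
  qed
  then show ?thesis
    using that[of "2 * b"] \<open>b \<ge> 0\<close> by simp
next
  case (dirac m)
  have Ym[measurable]: "Y \<in> borel_measurable M"
    using Y by (simp add: gaussian_rv_def)
  have "m \<noteq> u" using dirac nondeg by auto
  \<comment> \<open>The slope is chosen so that the linear bound reaches 1 exactly when the interval
    first contains the atom \<open>m\<close>; before that the probability is 0.\<close>
  have "prob {\<omega> \<in> space M. \<bar>Y \<omega> - u\<bar> \<le> t} \<le> 1 / \<bar>m - u\<bar> * t" if "t \<ge> 0" for t
  proof (cases "t < \<bar>m - u\<bar>")
    case True
    have "prob {\<omega> \<in> space M. \<bar>Y \<omega> - u\<bar> \<le> t} = 0"
      by (subst prob_eq_0) (use dirac True in \<open>auto elim!: eventually_mono\<close>)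
    then show ?thesis using that by simp
  next
    case False
    then show ?thesis
      using \<open>m \<noteq> u\<close> by (intro order_trans[OF prob_le_1]) (simp add: field_simps)
  qed
  then show ?thesis
    using that[of "1 / \<bar>m - u\<bar>"] by simp
qed

text \<open>Where the indicators differ, \<open>u\<close> lies between the two values, so the
  distance from \<open>Y\<close> to \<open>u\<close> is at most that from \<open>Y\<close> to
  \<open>Z\<close>. The two events thus cover the disagreement, whatever the joint law.\<close>

lemma expectation_indicator_diff_le:
  fixes Y Z :: "'a \<Rightarrow> real"
  assumes [measurable]: "Y \<in> borel_measurable M" "Z \<in> borel_measurable M"
  shows "expectation (\<lambda>\<omega>. (indicator {\<omega>. Y \<omega> \<ge> u} \<omega> - indicator {\<omega>. Z \<omega> \<ge> u} \<omega>)\<^sup>2)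
    \<le> prob {\<omega> \<in> space M. \<bar>Y \<omega> - u\<bar> \<le> t} + prob {\<omega> \<in> space M. \<bar>Y \<omega> - Z \<omega>\<bar> \<ge> t}"
proof -
  let ?A = "{\<omega> \<in> space M. \<bar>Y \<omega> - u\<bar> \<le> t}" and ?B = "{\<omega> \<in> space M. \<bar>Y \<omega> - Z \<omega>\<bar> \<ge> t}"
  have int: "integrable M (indicator ?A :: _ \<Rightarrow> real)" "integrable M (indicator ?B :: _ \<Rightarrow> real)"
    by (rule integrable_real_indicator; simp add: less_top[symmetric])+
  have "expectation (\<lambda>\<omega>. (indicator {\<omega>. Y \<omega> \<ge> u} \<omega> - indicator {\<omega>. Z \<omega> \<ge> u} \<omega>)\<^sup>2)
      \<le> expectation (\<lambda>\<omega>. indicator ?A \<omega> + indicator ?B \<omega> :: real)"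
    by (rule integral_mono_AE') (use int in \<open>auto simp: indicator_def[abs_def]\<close>)
  also have "\<dots> = prob ?A + prob ?B"
    using int by simp
  finally show ?thesis .
qed

text \<open>The constant involves only \<open>K\<close>, which comes from the law of
  \<open>Y\<close>, so one constant serves all predictors \<open>Z\<close>. The bound
  \<open>s < exp (- 1)\<close> makes the logarithmic factor at least 1, which absorbs the tail
  term.\<close>

lemma expectation_indicator_diff_gaussian:
  fixes Y Z :: "'a \<Rightarrow> real"
  assumes Ym: "Y \<in> borel_measurable M" and Zm: "Z \<in> borel_measurable M"
    and D: "gaussian_rv M (\<lambda>\<omega>. Y \<omega> - Z \<omega>)" and mean: "expectation (\<lambda>\<omega>. Y \<omega> - Z \<omega>) = 0"
    and K: "K \<ge> 0" "\<And>t. t \<ge> 0 \<Longrightarrow> prob {\<omega> \<in> space M. \<bar>Y \<omega> - u\<bar> \<le> t} \<le> K * t"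
    and s: "s = sqrt (variance (\<lambda>\<omega>. Y \<omega> - Z \<omega>))" "s < exp (- 1)"
  shows "expectation (\<lambda>\<omega>. (indicator {\<omega>. Y \<omega> \<ge> u} \<omega> - indicator {\<omega>. Z \<omega> \<ge> u} \<omega>)\<^sup>2)
    \<le> (2 * K + sqrt 2) * (s * sqrt \<bar>ln s\<bar>)"
proof (cases "s = 0")
  case True
  note [measurable] = Ym Zm
  \<comment> \<open>Zero variance excludes a density, and the constant value of the difference is
    its mean 0.\<close>
  have "AE \<omega> in M. Y \<omega> = Z \<omega>"
    using D
  proof (cases rule: gaussian_rv_cases)
    case (density m r)
    then show ?thesis
      using normal_distributed_variance[OF density] s(1) True by simp
  next
    case (dirac m)
    have "expectation (\<lambda>\<omega>. Y \<omega> - Z \<omega>) = expectation (\<lambda>\<omega>. m)"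
      by (rule integral_cong_AE) (use dirac in auto)
    then have "m = 0" using mean by (simp add: prob_space)
    with dirac show ?thesis by auto
  qed
  then have "expectation (\<lambda>\<omega>. (indicator {\<omega>. Y \<omega> \<ge> u} \<omega> - indicator {\<omega>. Z \<omega> \<ge> u} \<omega>)\<^sup>2)
      = expectation (\<lambda>\<omega>. 0 :: real)"
    by (intro integral_cong_AE) (auto simp: indicator_def elim!: eventually_mono)
  with True show ?thesis by simp
next
  case False
  have "variance (\<lambda>\<omega>. Y \<omega> - Z \<omega>) \<ge> 0" by simp
  then have "s > 0" and var: "variance (\<lambda>\<omega>. Y \<omega> - Z \<omega>) = s\<^sup>2"
    using False s(1) by (auto simp: less_le)
  have "ln s < - 1"
    using s(2) \<open>s > 0\<close> by (metis exp_gt_zero ln_exp ln_less_cancel_iff)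
  \<comment> \<open>This choice turns the tail exponent into \<open>ln s\<close>, so the exponential
    is \<open>s\<close> itself.\<close>
  define t where "t = 2 * (s * sqrt \<bar>ln s\<bar>)"
  have "t \<ge> 0" using \<open>s > 0\<close> by (simp add: t_def)
  have "- t\<^sup>2 / (4 * s\<^sup>2) = ln s"
    using \<open>s > 0\<close> \<open>ln s < - 1\<close> by (simp add: t_def power_mult_distrib)
  then have tail: "prob {\<omega> \<in> space M. \<bar>Y \<omega> - Z \<omega>\<bar> \<ge> t} \<le> sqrt 2 * s"
    using gaussian_rv_tail[OF D mean \<open>t \<ge> 0\<close>] var \<open>s > 0\<close> by simp
  have "s \<le> s * sqrt \<bar>ln s\<bar>"
    using \<open>s > 0\<close> \<open>ln s < - 1\<close> by simp
  then have "sqrt 2 * s \<le> sqrt 2 * (s * sqrt \<bar>ln s\<bar>)"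
    by (intro mult_left_mono) auto
  then show ?thesis
    using expectation_indicator_diff_le[OF Ym Zm, of u t] tail K(2)[OF \<open>t \<ge> 0\<close>]
    by (simp add: t_def algebra_simps)
qed

end

section \<open>Asymptotic order of the indicator error\<close>

theorem theorem1:
  fixes M :: "'w measure"
    and X :: "(real^'d) set"
    and l :: nat
    and k :: "(real^'d) \<Rightarrow> real"
    and \<xi>G :: "'d fmeasure \<Rightarrow> 'w \<Rightarrow> real"
    and \<xi> :: "(real^'d) \<Rightarrow> 'w \<Rightarrow> real"
    and xs :: "nat \<Rightarrow> real^'d"
    and u :: real
    and x :: "real^'d"
    and c :: "nat \<Rightarrow> nat \<Rightarrow> real"
    and \<xi>n :: "nat \<Rightarrow> 'w \<Rightarrow> real"
    and \<sigma> :: "nat \<Rightarrow> real"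
  assumes "prob_space M"
    and "IRF M X l k \<xi>G"
    and "representation M X l k \<xi>G \<xi>"
    and "gaussian_process M X \<xi>"
    and "separable_process M X \<xi>"
    and "\<exists>p\<in>polys_upto l. \<forall>y\<in>X. (\<integral>\<omega>. \<xi> y \<omega> \<partial>M) = p y"
    and "\<And>i. i \<ge> 1 \<Longrightarrow> xs i \<in> X"
    and "x \<in> X"
    and "\<forall>\<^sub>F n in sequentially. kriging_weights M X l \<xi> xs n x (c n)"
    and "\<And>n. \<xi>n n = kriging_predictor \<xi> xs n (c n)"
    and "\<And>n. \<sigma> n = sqrt (var M (\<lambda>\<omega>. \<xi> x \<omega> - \<xi>n n \<omega>))"
    and "\<sigma> \<longlonglongrightarrow> 0"
    and "\<not> (AE \<omega> in M. \<xi> x \<omega> = u)"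
  shows "(\<lambda>n. \<integral>\<omega>. (indicator {\<omega>. \<xi> x \<omega> \<ge> u} \<omega> - indicator {\<omega>. \<xi>n n \<omega> \<ge> u} \<omega>)\<^sup>2 \<partial>M)
           \<in> O(\<lambda>n. \<sigma> n * \<bar>ln (\<sigma> n)\<bar> powr (1/2))"
proof -
  interpret prob_space M by fact
  have sq: "second_order_rv M (\<xi> y)" if "y \<in> X" for y
    using assms(3) that by (simp add: representation_def)
  have int: "integrable M (\<xi> y)" and meas: "\<xi> y \<in> borel_measurable M" if "y \<in> X" for y
    using second_order_rv_integrable[OF sq[OF that]] sq[OF that] by (simp_all add: second_order_rv_def)
  obtain p where p: "p \<in> polys_upto l" "\<And>y. y \<in> X \<Longrightarrow> expectation (\<xi> y) = p y"
    using assms(6) by blast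
  have gauss: "gaussian_rv M (process_apply \<xi> \<nu>)" if "Poly_Mapping.keys \<nu> \<subseteq> X" for \<nu>
    using assms(4) that by (simp add: gaussian_process_def)
  have "process_apply \<xi> (Poly_Mapping.single x 1) = \<xi> x"
    by (simp add: fun_eq_iff process_apply_def fm_apply_single)
  then have "gaussian_rv M (\<xi> x)"
    using gauss[of "Poly_Mapping.single x 1"] \<open>x \<in> X\<close> by simp
  \<comment> \<open>\<open>K\<close> is fixed before \<open>n\<close>, since it depends only on
    \<open>u\<close> and the law of \<open>\<xi> x\<close>; this gives uniformity in the
    O-bound.\<close>
  then obtain K where K: "K \<ge> 0"
    "\<And>t. t \<ge> 0 \<Longrightarrow> prob {\<omega> \<in> space M. \<bar>\<xi> x \<omega> - u\<bar> \<le> t} \<le> K * t"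
    using gaussian_rv_small_ball assms(13) by blast
  have pred: "\<xi>n n \<in> borel_measurable M" for n
    unfolding assms(10) kriging_predictor_def[abs_def] using meas assms(7)
    by (intro borel_measurable_sum borel_measurable_times) auto
  have "\<forall>\<^sub>F n in sequentially. \<sigma> n < exp (- 1)"
    using assms(12) by (rule order_tendstoD) simp
  with assms(9) have "\<forall>\<^sub>F n in sequentially.
      norm (\<integral>\<omega>. (indicator {\<omega>. \<xi> x \<omega> \<ge> u} \<omega> - indicator {\<omega>. \<xi>n n \<omega> \<ge> u} \<omega> :: real)\<^sup>2 \<partial>M)
      \<le> (2 * K + sqrt 2) * norm (\<sigma> n * \<bar>ln (\<sigma> n)\<bar> powr (1/2))"
  proof eventually_elim
    case (elim n)
    \<comment> \<open>Admissibility of the weights makes the prediction error the process evaluated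
      at an increment, hence both Gaussian and centred.\<close>
    define \<nu> where "\<nu> = Poly_Mapping.single x 1 - (\<Sum>i=1..n. Poly_Mapping.single (xs i) (c n i))"
    have \<nu>: "\<nu> \<in> increments X l"
      using elim by (simp add: kriging_weights_def kriging_admissible_def \<nu>_def)
    have err: "process_apply \<xi> \<nu> = (\<lambda>\<omega>. \<xi> x \<omega> - \<xi>n n \<omega>)"
      unfolding \<nu>_def assms(10) by (rule ext) (rule process_apply_kriging_error)
    have "gaussian_rv M (\<lambda>\<omega>. \<xi> x \<omega> - \<xi>n n \<omega>)"
      using gauss[of \<nu>] \<nu> err by (simp add: increments_def)
    moreover have "expectation (\<lambda>\<omega>. \<xi> x \<omega> - \<xi>n n \<omega>) = 0"
      using expectation_process_increment[OF \<nu> p(1), of \<xi>] int p(2) err by simp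
    ultimately have "expectation (\<lambda>\<omega>. (indicator {\<omega>. \<xi> x \<omega> \<ge> u} \<omega> - indicator {\<omega>. \<xi>n n \<omega> \<ge> u} \<omega>)\<^sup>2)
        \<le> (2 * K + sqrt 2) * (\<sigma> n * sqrt \<bar>ln (\<sigma> n)\<bar>)"
      by (rule expectation_indicator_diff_gaussian[OF meas[OF \<open>x \<in> X\<close>] pred _ _ K assms(11) elim(2)])
    moreover have "\<sigma> n \<ge> 0" by (simp add: assms(11))
    ultimately show ?case
      by (simp add: powr_half_sqrt abs_mult)
  qed
  then show ?thesis by (rule bigoI)
qed

end
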